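(* Let $G$ be a graph of order $n$ and let $\mathcal{G}$ be an arbitrary abelian group of order $4n$ such that $\mathcal{G}\cong \mathbb{Z}_2\times\mathbb{Z}_2\times\mathcal{A}$ for some abelian group $\mathcal{A}$ of order $n$. Then there exists a $\mathcal{G}$-distance magic labeling of the graph $G[C_4]$.
   Context: All graphs are simple and finite. The order of a graph is its number of vertices; $N_G(x)$ is the set of vertices adjacent to $x$ in $G$. $C_4$ is the cycle of length 4. For graphs $G$ and $H$, $G[H]$ denotes the graph obtained from $G$ by replacing every vertex $x$ of $G$ by an isomorphic copy $H^{x}$ of $H$ (keeping the edges inside each copy), where for distinct $x,y\in V(G)$ a vertex of $H^{x}$ is adjacent to a vertex of $H^{y}$ if and only if $xy$ is an edge of $G$ (the lexicographic product). Thus $G[C_4]$ has $4|V(G)|$ vertices. For a graph $\Gamma$ with $N$ vertices and an abelian group $\mathcal{G}$ of order $N$ (written additively), a $\mathcal{G}$-distance magic labeling of $\Gamma$ is an injection $f:V(\Gamma)\to\mathcal{G}$ (hence a bijection) such that there is an element $\mu\in\mathcal{G}$ with $w(x)=\sum_{y\in N_\Gamma(x)}f(y)=\mu$ for every $x\in V(\Gamma)$. *)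

theory Defs
  imports "HOL-Algebra.Algebra" "Graph_Theory.Pair_Digraph"
begin

text \<open>
  A finite simple graph is a \<^locale>\<open>pair_graph\<close>: its edge relation is a
  symmetric, irreflexive set of ordered pairs, each undirected edge occurring as both of its
  orientations.
\<close>

definition neighbourhood :: "'a pair_pre_digraph \<Rightarrow> 'a \<Rightarrow> 'a set" where
  "neighbourhood G x = {y \<in> pverts G. (x, y) \<in> parcs G}"

text \<open>A cycle, hence a simple graph, only for lengths at least 3.\<close>

definition cycle_graph :: "nat \<Rightarrow> nat pair_pre_digraph" where
  "cycle_graph k =
    \<lparr> pverts = {..<k},
      parcs = {(i, j). i < k \<and> j < k \<and> (j = Suc i mod k \<or> i = Suc j mod k)} \<rparr>"

text \<open>
  In \<open>lex_product G H\<close>, the graph \<open>G[H]\<close>, the vertices \<open>(x, h)\<close> with \<open>x\<close>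
  fixed form the copy of \<open>H\<close> that replaces the vertex \<open>x\<close> of \<open>G\<close>.
\<close>

definition lex_product ::
    "'a pair_pre_digraph \<Rightarrow> 'b pair_pre_digraph \<Rightarrow> ('a \<times> 'b) pair_pre_digraph" where
  "lex_product G H =
    \<lparr> pverts = pverts G \<times> pverts H,
      parcs = {((x, h), (y, k)). x \<in> pverts G \<and> y \<in> pverts G \<and> h \<in> pverts H \<and> k \<in> pverts H \<and>
                 (x = y \<and> (h, k) \<in> parcs H \<or> x \<noteq> y \<and> (x, y) \<in> parcs G)} \<rparr>"

text \<open>
  Abelian groups are in the multiplicative notation of HOL-Algebra, so the weight of \<open>x\<close>
  (the sum of the labels of its neighbours) is a \<^const>\<open>finprod\<close>.
\<close>

definition weight ::
    "'a pair_pre_digraph \<Rightarrow> ('g, 'm) monoid_scheme \<Rightarrow> ('a \<Rightarrow> 'g) \<Rightarrow> 'a \<Rightarrow> 'g" where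
  "weight \<Gamma> \<G> f x = finprod \<G> f (neighbourhood \<Gamma> x)"

definition distance_magic_labeling ::
    "'a pair_pre_digraph \<Rightarrow> ('g, 'm) monoid_scheme \<Rightarrow> ('a \<Rightarrow> 'g) \<Rightarrow> bool" where
  "distance_magic_labeling \<Gamma> \<G> f \<longleftrightarrow>
    order \<G> = card (pverts \<Gamma>) \<and>
    f \<in> pverts \<Gamma> \<rightarrow> carrier \<G> \<and> inj_on f (pverts \<Gamma>) \<and>
    (\<exists>\<mu> \<in> carrier \<G>. \<forall>x \<in> pverts \<Gamma>. weight \<Gamma> \<G> f x = \<mu>)"

lemma pair_graph_cycle_graph:
  assumes "k \<ge> 3"
  shows "pair_graph (cycle_graph k)"
proof
  show "finite (pverts (cycle_graph k))"
    by (simp add: cycle_graph_def)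
  have "parcs (cycle_graph k) \<subseteq> {..<k} \<times> {..<k}"
    by (auto simp: cycle_graph_def)
  then show "finite (parcs (cycle_graph k))"
    by (rule finite_subset) simp
  show "symmetric (with_proj (cycle_graph k))"
    by (auto simp: symmetric_def cycle_graph_def sym_def)
next
  fix e assume e: "e \<in> parcs (cycle_graph k)"
  then show "fst e \<in> pverts (cycle_graph k)" "snd e \<in> pverts (cycle_graph k)"
    by (auto simp: cycle_graph_def)
  have "Suc i mod k \<noteq> i" if "i < k" for i
    using that assms by (cases "Suc i = k") auto
  then show "fst e \<noteq> snd e"
    using e by (fastforce simp: cycle_graph_def)
qed

lemma pair_graph_lex_product:
  assumes "pair_graph G" "pair_graph H"
  shows "pair_graph (lex_product G H)"
proof -
  interpret G: pair_graph G by fact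
  interpret H: pair_graph H by fact
  show ?thesis
  proof
    show fin: "finite (pverts (lex_product G H))"
      using G.pair_finite_verts H.pair_finite_verts by (simp add: lex_product_def)
    have "parcs (lex_product G H) \<subseteq> pverts (lex_product G H) \<times> pverts (lex_product G H)"
      by (auto simp: lex_product_def)
    then show "finite (parcs (lex_product G H))"
      using fin by (meson finite_SigmaI finite_subset)
    show "symmetric (with_proj (lex_product G H))"
      using G.pair_sym_arcs H.pair_sym_arcs
      by (auto simp: symmetric_def lex_product_def sym_def)
  next
    fix e assume e: "e \<in> parcs (lex_product G H)"
    then show "fst e \<in> pverts (lex_product G H)" "snd e \<in> pverts (lex_product G H)"
      by (auto simp: lex_product_def)
    show "fst e \<noteq> snd e"
      using e H.pair_no_loops by (fastforce simp: lex_product_def)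
  qed
qed

lemma card_lex_product:
  "card (pverts (lex_product G H)) = card (pverts G) * card (pverts H)"
  by (simp add: lex_product_def card_cartesian_product)

end

theory Submission
  imports Defs
begin

text \<open>
  It suffices to label \<open>G[C\<^sub>4]\<close> bijectively so that in every copy of \<open>C\<^sub>4\<close> the two labels on
  each of the two pairs of opposite vertices have the same product \<open>s\<close>, where \<open>s \<otimes> s = \<one>\<close> and
  \<open>s\<close> does not depend on the copy. The neighbours of a vertex then consist of one opposite pair in
  its own copy, contributing \<open>s\<close>, and of whole copies of \<open>C\<^sub>4\<close>, each contributing
  \<open>s \<otimes> s = \<one>\<close>; so every weight is \<open>s\<close>, whatever the graph \<open>G\<close> is
  (\<open>weight_lex_product_C4\<close>).

  In additive notation, \<open>s = (1, 0, 0)\<close> works in \<open>\<int>\<^sub>2 \<times> \<int>\<^sub>2 \<times> \<A>\<close>. It has order two,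
  and the elements pair off into
  \<open>{(0, 0, a), (1, 0, -a)}\<close> and \<open>{(0, 1, a), (1, 1, -a)}\<close>, each with sum \<open>s\<close>. Both pairs
  belonging to the same \<open>a\<close> are given to one copy of \<open>C\<^sub>4\<close>; there are as many copies as elements
  \<open>a\<close>, so all labels are used once. An isomorphism carries this labelling over to \<open>\<G>\<close>.
\<close>

lemma neighbourhood_lex_product:
  assumes "x \<in> pverts G" "h \<in> pverts H"
  shows "neighbourhood (lex_product G H) (x, h) =
    {x} \<times> neighbourhood H h \<union> (neighbourhood G x - {x}) \<times> pverts H"
  using assms by (auto simp: neighbourhood_def lex_product_def)

lemma neighbourhood_cycle_graph_4:
  assumes "h < 4"
  shows "neighbourhood (cycle_graph 4) h = (if even h then {1, 3} else {0, 2})"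
proof -
  have h: "h = 0 \<or> h = 1 \<or> h = 2 \<or> h = 3"
    using assms by linarith
  have "k \<in> neighbourhood (cycle_graph 4) h \<longleftrightarrow> k \<in> (if even h then {1, 3} else {0, 2})" for k
  proof -
    have "k = 0 \<or> k = 1 \<or> k = 2 \<or> k = 3 \<or> k \<ge> 4"
      by linarith
    then show ?thesis
      using h by (elim disjE; simp add: neighbourhood_def cycle_graph_def)
  qed
  then show ?thesis
    by blast
qed

text \<open>
  In \<open>C\<^sub>4\<close> the opposite pairs are \<open>{0, 2}\<close> and \<open>{1, 3}\<close>, and the neighbourhood of each vertex is
  the pair not containing it. A whole copy, being the union of both pairs, has product
  \<open>s \<otimes> s = \<one>\<close>.
\<close>

lemma weight_lex_product_C4:
  fixes f :: "'a \<times> nat \<Rightarrow> 'g"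
  assumes "comm_group M" and "finite (pverts G)"
    and closed: "\<And>y k. y \<in> pverts G \<Longrightarrow> k < 4 \<Longrightarrow> f (y, k) \<in> carrier M"
    and opposite: "\<And>y k. y \<in> pverts G \<Longrightarrow> k < 2 \<Longrightarrow> f (y, k) \<otimes>\<^bsub>M\<^esub> f (y, k + 2) = s"
    and s: "s \<otimes>\<^bsub>M\<^esub> s = \<one>\<^bsub>M\<^esub>"
    and x: "x \<in> pverts G" "h < 4"
  shows "weight (lex_product G (cycle_graph 4)) M f (x, h) = s"
proof -
  interpret M: comm_group M by fact
  let ?N = "neighbourhood G x - {x}"
  have N: "?N \<subseteq> pverts G" "finite ?N"
    using assms(2) by (auto simp: neighbourhood_def)
  have pair0: "finprod M f {(y, 0), (y, 2)} = s" and pair1: "finprod M f {(y, 1), (y, 3)} = s"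
    if "y \<in> pverts G" for y
    using that closed[of y] opposite[of y 0] opposite[of y 1]
    by (simp_all add: eval_nat_numeral)
  have own: "{x} \<times> neighbourhood (cycle_graph 4) h =
      (if even h then {(x, 1), (x, 3)} else {(x, 0), (x, 2)})"
    using x by (auto simp: neighbourhood_cycle_graph_4)
  have copy: "finprod M f ({y} \<times> {..<4}) = \<one>\<^bsub>M\<^esub>" if y: "y \<in> pverts G" for y
  proof -
    have "{y} \<times> {..<4} = {(y, 0), (y, 2)} \<union> {(y, 1), (y, 3 :: nat)}"
      by auto
    then show ?thesis
      using closed[OF y] pair0[OF y] pair1[OF y] s by (simp only:) (subst M.finprod_Un_disjoint; simp)
  qed
  have "?N \<times> {..<4 :: nat} = (\<Union>y \<in> ?N. {y} \<times> {..<4})"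
    by auto
  then have "finprod M f (?N \<times> {..<4}) = finprod M (\<lambda>y. finprod M f ({y} \<times> {..<4})) ?N"
    using N closed
    by (simp only:) (subst M.finprod_UN_disjoint; auto simp: pairwise_def disjnt_def)
  also have "\<dots> = \<one>\<^bsub>M\<^esub>"
    by (intro M.finprod_one_eqI copy) (use N in auto)
  finally have others: "finprod M f (?N \<times> {..<4}) = \<one>\<^bsub>M\<^esub>" .
  have s_closed: "s \<in> carrier M"
    using opposite[OF x(1), of 0] M.m_closed[OF closed closed, OF x(1) _ x(1), of 0 2]
    by (simp add: eval_nat_numeral)
  have "weight (lex_product G (cycle_graph 4)) M f (x, h) =
      finprod M f ({x} \<times> neighbourhood (cycle_graph 4) h \<union> ?N \<times> {..<4})"
    using x by (simp add: weight_def neighbourhood_lex_product cycle_graph_def)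
  also have "\<dots> = finprod M f ({x} \<times> neighbourhood (cycle_graph 4) h)
      \<otimes>\<^bsub>M\<^esub> finprod M f (?N \<times> {..<4})"
    unfolding own using N closed x by (intro M.finprod_Un_disjoint) auto
  also have "\<dots> = s"
    using others s_closed pair0[OF x(1)] pair1[OF x(1)] by (simp add: own)
  finally show ?thesis .
qed

text \<open>
  Writing \<open>h < 4\<close> in binary, its low bit names the opposite pair and becomes the second
  coordinate; its high bit names the member of the pair and becomes the first coordinate, with the
  third coordinate inverted between the two members. Hence opposite labels multiply to
  \<open>(1, 0, \<one>)\<close>.
\<close>

definition C4_label ::
    "('h, 'k) monoid_scheme \<Rightarrow> ('a \<Rightarrow> 'h) \<Rightarrow> 'a \<times> nat \<Rightarrow> int \<times> int \<times> 'h" where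
  "C4_label \<A> a = (\<lambda>(x, h).
    (int (h div 2), int (h mod 2), if h < 2 then a x else inv\<^bsub>\<A>\<^esub> a x))"

lemma C4_label_closed:
  assumes "group \<A>" "a x \<in> carrier \<A>" "h < 4"
  shows "C4_label \<A> a (x, h) \<in>
    carrier (integer_mod_group 2 \<times>\<times> integer_mod_group 2 \<times>\<times> \<A>)"
  using assms by (auto simp: C4_label_def carrier_integer_mod_group group.inv_closed)

lemma C4_label_opposite:
  assumes "group \<A>" "a x \<in> carrier \<A>" "h < 2"
  shows "C4_label \<A> a (x, h) \<otimes>\<^bsub>integer_mod_group 2 \<times>\<times> integer_mod_group 2 \<times>\<times> \<A>\<^esub>
    C4_label \<A> a (x, h + 2) = (1, 0, \<one>\<^bsub>\<A>\<^esub>)"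
proof -
  have "h = 0 \<or> h = 1"
    using assms(3) by linarith
  then show ?thesis
    using assms by (auto simp: C4_label_def group.r_inv)
qed

lemma inj_on_C4_label:
  assumes "group \<A>" "inj_on a V" "a ` V \<subseteq> carrier \<A>"
  shows "inj_on (C4_label \<A> a) (V \<times> {..<4})"
proof (rule inj_onI, clarify)
  fix x h y k
  assume *: "x \<in> V" "y \<in> V" and eq: "C4_label \<A> a (x, h) = C4_label \<A> a (y, k)"
  have "h div 2 = k div 2" "h mod 2 = k mod 2"
    using eq by (simp_all only: C4_label_def prod.case prod.inject of_nat_eq_iff)
  then have "h = k"
    by (metis div_mult_mod_eq)
  have third: "(if h < 2 then a x else inv\<^bsub>\<A>\<^esub> a x) = (if h < 2 then a y else inv\<^bsub>\<A>\<^esub> a y)"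
    using eq unfolding \<open>h = k\<close> by (simp only: C4_label_def prod.case prod.inject)
  have "a x \<in> carrier \<A>" "a y \<in> carrier \<A>"
    using * assms(3) by auto
  then have "a x = a y"
    using third group.inv_inv[OF assms(1)] by metis
  then show "x = y \<and> h = k"
    using * assms(2) \<open>h = k\<close> by (auto dest: inj_onD)
qed

theorem theorem2p2:
  fixes G :: "'a pair_pre_digraph"
    and \<G> :: "('g, 'm) monoid_scheme"
    and \<A> :: "('h, 'k) monoid_scheme"
    and n :: nat
  assumes "pair_graph G" and "card (pverts G) = n"
    and "comm_group \<G>" and "finite (carrier \<G>)" and "order \<G> = 4 * n"
    and "comm_group \<A>" and "finite (carrier \<A>)" and "order \<A> = n"
    and "\<G> \<cong> integer_mod_group 2 \<times>\<times> integer_mod_group 2 \<times>\<times> \<A>"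
  shows "\<exists>f. distance_magic_labeling (lex_product G (cycle_graph 4)) \<G> f"
proof -
  interpret G: pair_graph G by fact
  interpret \<G>: comm_group \<G> by fact
  interpret \<A>: comm_group \<A> by fact
  let ?P = "integer_mod_group 2 \<times>\<times> integer_mod_group 2 \<times>\<times> \<A>"
  interpret P: group ?P
    by (intro DirProd_group group_integer_mod_group \<A>.is_group)
  obtain \<phi> where "\<phi> \<in> iso ?P \<G>"
    using \<G>.iso_sym[OF assms(9)] by (auto simp: is_iso_def)
  then have hom: "\<phi> \<in> hom ?P \<G>" and inj: "inj_on \<phi> (carrier ?P)"
    by (auto simp: iso_def bij_betw_def)
  obtain a where a: "bij_betw a (pverts G) (carrier \<A>)"
    using finite_same_card_bij[OF G.pair_finite_verts assms(7)] assms(2,8) by (auto simp: order_def)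
  let ?l = "C4_label \<A> a" and ?V = "pverts G \<times> {..<4 :: nat}"
  let ?s = "(1, 0, \<one>\<^bsub>\<A>\<^esub>) :: int \<times> int \<times> 'h"
  have a_closed: "a x \<in> carrier \<A>" if "x \<in> pverts G" for x
    using a that by (rule bij_betw_apply)
  have l: "?l (x, h) \<in> carrier ?P" if "x \<in> pverts G" "h < 4" for x h
    using that by (intro C4_label_closed \<A>.is_group a_closed)
  have opposite: "(\<phi> \<circ> ?l) (x, h) \<otimes>\<^bsub>\<G>\<^esub> (\<phi> \<circ> ?l) (x, h + 2) = \<phi> ?s"
    if "x \<in> pverts G" "h < 2" for x h
  proof -
    have "\<phi> (?l (x, h)) \<otimes>\<^bsub>\<G>\<^esub> \<phi> (?l (x, h + 2)) = \<phi> (?l (x, h) \<otimes>\<^bsub>?P\<^esub> ?l (x, h + 2))"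
      using that by (intro hom_mult[OF hom, symmetric] l) auto
    also have "?l (x, h) \<otimes>\<^bsub>?P\<^esub> ?l (x, h + 2) = ?s"
      using that by (intro C4_label_opposite \<A>.is_group a_closed)
    finally show ?thesis
      by simp
  qed
  have s_closed: "?s \<in> carrier ?P"
    by (simp add: carrier_integer_mod_group)
  have "?s \<otimes>\<^bsub>?P\<^esub> ?s = \<one>\<^bsub>?P\<^esub>"
    by simp
  then have s_square: "\<phi> ?s \<otimes>\<^bsub>\<G>\<^esub> \<phi> ?s = \<one>\<^bsub>\<G>\<^esub>"
    using hom_mult[OF hom s_closed s_closed] hom_one[OF hom P.is_group \<G>.is_group] by metis
  have weight: "weight (lex_product G (cycle_graph 4)) \<G> (\<phi> \<circ> ?l) (x, h) = \<phi> ?s"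
    if "x \<in> pverts G" "h < 4" for x h
    using that opposite s_square l hom
    by (intro weight_lex_product_C4 \<G>.comm_group_axioms G.pair_finite_verts)
      (auto intro: hom_in_carrier)
  have V: "pverts (lex_product G (cycle_graph 4)) = ?V"
    by (simp add: lex_product_def cycle_graph_def)
  have "inj_on ?l ?V"
    using a by (intro inj_on_C4_label \<A>.is_group) (auto simp: bij_betw_def)
  moreover have "?l ` ?V \<subseteq> carrier ?P"
    using l by (auto simp del: carrier_DirProd)
  ultimately have "inj_on (\<phi> \<circ> ?l) ?V"
    using inj by (blast intro: comp_inj_on inj_on_subset)
  moreover have "(\<phi> \<circ> ?l) (x, h) \<in> carrier \<G>" if "x \<in> pverts G" "h < 4" for x h
    using hom_in_carrier[OF hom l[OF that]] by simp
  ultimately have "distance_magic_labeling (lex_product G (cycle_graph 4)) \<G> (\<phi> \<circ> ?l)"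
    unfolding distance_magic_labeling_def V
    using assms(2,5) weight hom_in_carrier[OF hom s_closed]
    by (auto simp: card_cartesian_product)
  then show ?thesis
    by blast
qed

end
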